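(* Let $d\ge2$, let $\Sigma$ be a symmetric positive definite $d\times d$ matrix, let $X\sim\mathcal{N}(0,\Sigma)$ with density $p$, and let $\beta\in\mathbb{R}$, $\beta\ne2$. Put $$\boldsymbol\tau_{2,\beta}(x)=\frac{\beta}{(\beta-2)(d-1)}\left(x^T\Sigma^{-1}x\,\Sigma-xx^T\right)-\frac{2}{\beta-2}\,\Sigma .$$ Then for all $g:\mathbb{R}^d\to\mathbb{R}$ in $\mathrm{dom}(p,\boldsymbol\tau_{2,\beta})$, $$\frac{\beta}{(\beta-2)(d-1)}\,\mathbb{E}\left[\left(X^T\Sigma^{-1}X\,\Sigma-XX^T\right)\nabla g(X)\right]=\mathbb{E}\left[\frac{2}{\beta-2}\,\Sigma\nabla g(X)+X\,g(X)\right].$$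
   Context: $\nabla g$ is a column vector. Here $p>0$ is smooth on $\mathbb{R}^d$. $\mathcal{F}_1(p)$ is the set of $\mathcal{C}^1$ functions $\varphi:\mathbb{R}^d\to\mathbb{R}$ such that $p\varphi$ has Lebesgue-integrable gradient and $\int_{\mathbb{R}^d}\partial_i(p\varphi)=0$ for $i=1,\dots,d$. For a matrix valued function $\mathbf{F}$ with all components in $\mathcal{F}_1(p)$, a scalar function $g$ belongs to $\mathrm{dom}(p,\mathbf{F})$ if $g$ is $\mathcal{C}^1$, all components of $\mathbf{F}g$ belong to $\mathcal{F}_1(p)$, and all components of $\mathbf{F}\,\partial_eg$ are in $L^1(p)$ for every unit vector $e$. *)

theory Defs
  imports "HOL-Probability.Probability"
begin

definition dir_deriv :: "(real ^ 'n \<Rightarrow> real) \<Rightarrow> real ^ 'n \<Rightarrow> real ^ 'n \<Rightarrow> real" where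
  "dir_deriv f e x = frechet_derivative f (at x) e"

definition grad :: "(real ^ 'n \<Rightarrow> real) \<Rightarrow> real ^ 'n \<Rightarrow> real ^ 'n" where
  "grad f x = (\<chi> i. dir_deriv f (axis i 1) x)"

definition C1_fun :: "(real ^ 'n \<Rightarrow> real) \<Rightarrow> bool" where
  "C1_fun f \<longleftrightarrow> (\<forall>x. f differentiable (at x)) \<and> continuous_on UNIV (grad f)"

definition L1_weighted :: "(real ^ 'n \<Rightarrow> real) \<Rightarrow> (real ^ 'n \<Rightarrow> real) set" where
  "L1_weighted p = {f. integrable (density lborel (\<lambda>x. ennreal (p x))) f}"

definition stein_F1 :: "(real ^ 'n \<Rightarrow> real) \<Rightarrow> (real ^ 'n \<Rightarrow> real) set" where
  "stein_F1 p = {\<phi>. C1_fun \<phi> \<and>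
     integrable lborel (grad (\<lambda>x. p x * \<phi> x)) \<and>
     (\<forall>i. (\<integral>x. grad (\<lambda>x. p x * \<phi> x) x $ i \<partial>lborel) = 0)}"

(* Meant for F all of whose components lie in stein_F1 p; this concerns p and F only,
   so it is not repeated in the membership condition on g. *)
definition stein_dom ::
  "(real ^ 'n \<Rightarrow> real) \<Rightarrow> (real ^ 'n \<Rightarrow> real ^ 'k ^ 'm) \<Rightarrow> (real ^ 'n \<Rightarrow> real) set" where
  "stein_dom p F = {g. C1_fun g \<and>
     (\<forall>i j. (\<lambda>x. F x $ i $ j * g x) \<in> stein_F1 p) \<and>
     (\<forall>e. norm e = 1 \<longrightarrow> (\<forall>i j. (\<lambda>x. F x $ i $ j * dir_deriv g e x) \<in> L1_weighted p))}"

definition sym_pos_def :: "real ^ 'n ^ 'n \<Rightarrow> bool" where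
  "sym_pos_def A \<longleftrightarrow> transpose A = A \<and> (\<forall>x. x \<noteq> 0 \<longrightarrow> 0 < x \<bullet> (A *v x))"

definition mvn_density :: "real ^ 'n ^ 'n \<Rightarrow> real ^ 'n \<Rightarrow> real" where
  "mvn_density \<Sigma> x =
     exp (- (x \<bullet> (matrix_inv \<Sigma> *v x)) / 2) / sqrt ((2 * pi) ^ CARD('n) * det \<Sigma>)"

definition outer_prod :: "real ^ 'n \<Rightarrow> real ^ 'n \<Rightarrow> real ^ 'n ^ 'n" where
  "outer_prod x y = (\<chi> i j. x $ i * y $ j)"

definition tau2 :: "real ^ 'n ^ 'n \<Rightarrow> real \<Rightarrow> real ^ 'n \<Rightarrow> real ^ 'n ^ 'n" where
  "tau2 \<Sigma> \<beta> x =
     (\<beta> / ((\<beta> - 2) * (real CARD('n) - 1))) *\<^sub>R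
       ((x \<bullet> (matrix_inv \<Sigma> *v x)) *\<^sub>R \<Sigma> - outer_prod x x)
     - (2 / (\<beta> - 2)) *\<^sub>R \<Sigma>"

end

(* The matrix tau = tau2 Sigma beta is a Stein kernel of p: the divergence of p tau is - p x. The
   classes F_1(p) and dom(p, tau) make the boundary terms of the integration by parts vanish, which
   gives E[tau grad g] = E[X g]. To split tau grad g into its two parts one needs the
   p-integrability of grad g itself. It comes from tr(Sigma^-1 tau) = (beta q - 2 d) / (beta - 2),
   where q x = x . Sigma^-1 x: for beta nonzero this is bounded away from 0 outside a compact set,
   and for beta = 0 the first part vanishes. *)
theory Submission
  imports Defs
begin

section \<open>Directional derivatives, componentwise integrals, and integration by parts on
  \<open>stein_dom\<close>\<close>

lemma C1_fun_continuous:
  assumes "C1_fun g"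
  shows "continuous_on UNIV g" "continuous_on UNIV (grad g)"
  using assms unfolding C1_fun_def
  by (meson continuous_at_imp_continuous_on differentiable_imp_continuous_within)+

lemma dir_deriv_eq: "(f has_derivative f') (at x) \<Longrightarrow> dir_deriv f e x = f' e"
  by (simp add: dir_deriv_def frechet_derivative_at[symmetric])

lemma dir_deriv_mult:
  assumes "f differentiable (at x)" "g differentiable (at x)"
  shows "dir_deriv (\<lambda>x. f x * g x) e x = f x * dir_deriv g e x + dir_deriv f e x * g x"
proof -
  have "(f has_derivative frechet_derivative f (at x)) (at x)"
       "(g has_derivative frechet_derivative g (at x)) (at x)"
    using assms by (simp_all add: frechet_derivative_works)
  from has_derivative_mult[OF this] show ?thesis
    by (subst dir_deriv_eq) (auto simp: dir_deriv_def)
qed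

lemma integrable_vec_iff:
  fixes f :: "'a \<Rightarrow> real ^ 'n"
  shows "integrable N f \<longleftrightarrow> (\<forall>i. integrable N (\<lambda>x. f x $ i))"
proof
  assume "\<forall>i. integrable N (\<lambda>x. f x $ i)"
  then have "integrable N (\<lambda>x. \<Sum>i\<in>UNIV. f x $ i *\<^sub>R axis i (1::real))" by auto
  moreover have "(\<Sum>i\<in>UNIV. f x $ i *\<^sub>R axis i (1::real)) = f x" for x
    by (simp add: vec_eq_iff axis_def if_distrib cong: if_cong)
  ultimately show "integrable N f" by simp
qed (auto intro: integrable_bounded_linear[OF bounded_linear_vec_nth])

lemma integral_vec_nth:
  fixes f :: "'a \<Rightarrow> real ^ 'n"
  shows "integrable N f \<Longrightarrow> integral\<^sup>L N f $ i = (\<integral>x. f x $ i \<partial>N)"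
  by (rule integral_bounded_linear[OF bounded_linear_vec_nth, symmetric])

text \<open>The divergence of \<open>p * g\<close> times row \<open>i\<close> of \<open>F\<close>
  integrates to 0, because every term of it comes from a member of \<open>stein_F1 p\<close>. By the
  product rule this divergence is \<open>p\<close> times row \<open>i\<close> of \<open>F\<close>
  applied to \<open>grad g\<close>, minus \<open>p * v * g\<close>. The first summand is integrable
  by the L1 condition on \<open>F\<close> times directional derivatives, so the second is
  too.\<close>

lemma stein_dom_integration_by_parts:
  fixes F :: "real ^ 'n \<Rightarrow> real ^ 'n ^ 'm" and v :: "real ^ 'n \<Rightarrow> real"
  assumes g: "g \<in> stein_dom p F"
    and p: "\<And>x. 0 \<le> p x" "p \<in> borel_measurable borel"
    and diff: "\<And>x j. (\<lambda>x. p x * F x $ i $ j) differentiable (at x)"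
    and div: "\<And>x. (\<Sum>j\<in>UNIV. dir_deriv (\<lambda>x. p x * F x $ i $ j) (axis j 1) x) = - p x * v x"
    and v: "v \<in> borel_measurable borel"
  shows "integrable (density lborel (\<lambda>x. ennreal (p x))) (\<lambda>x. v x * g x)" (is ?I)
    and "(\<integral>x. (F x *v grad g x) $ i \<partial>density lborel (\<lambda>x. ennreal (p x))) =
         (\<integral>x. v x * g x \<partial>density lborel (\<lambda>x. ennreal (p x)))" (is ?E)
proof -
  let ?N = "density lborel (\<lambda>x. ennreal (p x))"
  have C1: "C1_fun g" using g by (simp add: stein_dom_def)
  note [measurable] = borel_measurable_continuous_onI[OF C1_fun_continuous(1)[OF C1]] p(2) v
  define G where "G j x = grad (\<lambda>x. p x * (F x $ i $ j * g x)) x $ j" for j x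
  have "integrable lborel (\<lambda>x. G j x)" "(\<integral>x. G j x \<partial>lborel) = 0" for j
    using g unfolding G_def stein_dom_def stein_F1_def by (auto simp: integrable_vec_iff)
  then have sumG: "integrable lborel (\<lambda>x. \<Sum>j\<in>UNIV. G j x)" "(\<integral>x. (\<Sum>j\<in>UNIV. G j x) \<partial>lborel) = 0"
    by auto
  have "integrable ?N (\<lambda>x. F x $ i $ j * dir_deriv g (axis j 1) x)" for j
    using g unfolding stein_dom_def L1_weighted_def by (auto simp: norm_axis_1)
  then have F: "integrable ?N (\<lambda>x. (F x *v grad g x) $ i)"
    by (auto simp: matrix_vector_mult_def grad_def)
  have pF: "integrable lborel (\<lambda>x. p x * (F x *v grad g x) $ i)"
  proof -
    \<comment> \<open>Measurability of \<open>F\<close> is not among the hypotheses; for this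
      product it is read off from integrability under the density.\<close>
    have "(\<lambda>x. (F x *v grad g x) $ i) \<in> borel_measurable borel"
      using borel_measurable_integrable[OF F] by simp
    then show ?thesis using F p by (subst (asm) integrable_density) auto
  qed
  \<comment> \<open>The product \<open>p * F_ij\<close> is kept as one factor in the product rule,
    since \<open>diff\<close> and \<open>div\<close> speak of it as a whole.\<close>
  have key: "p x * (v x * g x) = p x * (F x *v grad g x) $ i - (\<Sum>j\<in>UNIV. G j x)" for x
  proof -
    have "G j x = dir_deriv (\<lambda>x. p x * F x $ i $ j * g x) (axis j 1) x" for j
      by (simp add: G_def grad_def mult.assoc)
    also have "\<dots> j = p x * (F x $ i $ j * grad g x $ j)
        + dir_deriv (\<lambda>x. p x * F x $ i $ j) (axis j 1) x * g x" for j
      using C1 diff by (subst dir_deriv_mult) (auto simp: C1_fun_def grad_def)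
    finally show ?thesis
      using div[of x]
      by (simp add: sum.distrib matrix_vector_mult_def sum_distrib_left[symmetric]
          sum_distrib_right[symmetric])
  qed
  have "integrable lborel (\<lambda>x. p x * (v x * g x))"
    unfolding key using pF sumG by auto
  then show ?I using p by (subst integrable_density) auto
  have "(\<integral>x. p x * (v x * g x) \<partial>lborel) = (\<integral>x. p x * (F x *v grad g x) $ i \<partial>lborel)"
    unfolding key using pF sumG by auto
  moreover have "(\<lambda>x. (F x *v grad g x) $ i) \<in> borel_measurable borel"
    using borel_measurable_integrable[OF F] by simp
  ultimately show ?E using p by (simp add: integral_density)
qed

text \<open>Outside the ball \<open>f\<close> is dominated by \<open>h * f\<close>; on the ball it
  is bounded by compactness, and constants are integrable for a finite measure.\<close>

lemma integrable_of_integrable_mult_bounded_below: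
  fixes f h :: "real ^ 'n \<Rightarrow> real"
  assumes hf: "integrable N (\<lambda>x. h x * f x)"
    and N: "finite_measure N" "sets N = sets borel"
    and f: "continuous_on UNIV f"
    and h: "\<And>x. R \<le> norm x \<Longrightarrow> 1 \<le> \<bar>h x\<bar>"
  shows "integrable N f"
proof -
  interpret finite_measure N by fact
  have "compact (f ` cball 0 R)"
    using f by (intro compact_continuous_image) (auto intro: continuous_on_subset)
  then obtain B where B: "\<And>x. norm x \<le> R \<Longrightarrow> \<bar>f x\<bar> \<le> B"
    by (force dest!: compact_imp_bounded simp: bounded_iff)
  have meas: "f \<in> borel_measurable N"
    using borel_measurable_continuous_onI[OF f] by (simp cong: measurable_cong_sets add: N)
  show ?thesis
  \<comment> \<open>The absolute value of \<open>B\<close> covers a negative \<open>R\<close>: the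
    ball is then empty and \<open>B\<close> may be negative.\<close>
  proof (rule Bochner_Integration.integrable_bound[where f = "\<lambda>x. \<bar>h x * f x\<bar> + \<bar>B\<bar>"])
    show "integrable N (\<lambda>x. \<bar>h x * f x\<bar> + \<bar>B\<bar>)" using hf by auto
    show "AE x in N. norm (f x) \<le> norm (\<bar>h x * f x\<bar> + \<bar>B\<bar>)"
    proof (intro AE_I2)
      fix x
      show "norm (f x) \<le> norm (\<bar>h x * f x\<bar> + \<bar>B\<bar>)"
      proof (cases "norm x \<le> R")
        case True
        then show ?thesis using B[of x] by simp
      next
        case False
        then have "1 * \<bar>f x\<bar> \<le> \<bar>h x\<bar> * \<bar>f x\<bar>" using h[of x] by (intro mult_right_mono) auto
        then show ?thesis by (simp add: abs_mult)
      qed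
    qed
  qed (rule meas)
qed

section \<open>The inverse of a positive definite matrix and its quadratic form\<close>

locale pos_def_matrix =
  fixes \<Sigma> :: "real ^ 'n ^ 'n"
  assumes pos_def: "sym_pos_def \<Sigma>"
begin

text \<open>For the normal law, \<open>A\<close> is the precision matrix and \<open>q\<close> the
  squared Mahalanobis norm.\<close>

definition A :: "real ^ 'n ^ 'n" where "A = matrix_inv \<Sigma>"
definition q :: "real ^ 'n \<Rightarrow> real" where "q x = x \<bullet> (A *v x)"

lemma transpose_Sigma: "transpose \<Sigma> = \<Sigma>"
  using pos_def by (simp add: sym_pos_def_def)

text \<open>Positive definiteness makes the kernel trivial, hence the square matrix invertible, so
  the choice hidden in \<open>matrix_inv\<close> picks a genuine two-sided inverse.\<close>

lemma inverse_Sigma: "A ** \<Sigma> = mat 1" "\<Sigma> ** A = mat 1"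
proof -
  have "x = 0" if "\<Sigma> *v x = 0" for x
    using pos_def that unfolding sym_pos_def_def by (metis inner_zero_right less_irrefl)
  then have "invertible \<Sigma>"
    using invertible_left_inverse matrix_left_invertible_ker by blast
  then have "\<Sigma> ** A = mat 1 \<and> A ** \<Sigma> = mat 1"
    unfolding A_def matrix_inv_def invertible_def by (rule someI_ex)
  then show "A ** \<Sigma> = mat 1" "\<Sigma> ** A = mat 1" by auto
qed

lemma Sigma_A_apply: "\<Sigma> *v (A *v x) = x"
  by (simp add: matrix_vector_mul_assoc inverse_Sigma)

text \<open>Transposing \<open>\<Sigma> ** A = mat 1\<close> makes \<open>transpose A\<close> a left
  inverse of \<open>\<Sigma>\<close>, and inverses are unique.\<close>

lemma transpose_A: "transpose A = A"
proof -
  have "transpose A ** \<Sigma> = mat 1"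
    using inverse_Sigma(2) transpose_Sigma by (metis matrix_transpose_mul transpose_mat)
  then show ?thesis
    using inverse_Sigma by (metis matrix_mul_assoc matrix_mul_lid matrix_mul_rid)
qed

lemma A_inner_commute: "x \<bullet> (A *v y) = (A *v x) \<bullet> y"
  by (metis dot_lmul_matrix transpose_A transpose_matrix_vector)

text \<open>With y = \<open>A *v x\<close>, which is nonzero, \<open>q x\<close> is the quadratic
  form of \<open>\<Sigma>\<close> at y.\<close>

lemma q_pos: "x \<noteq> 0 \<Longrightarrow> 0 < q x"
proof -
  assume "x \<noteq> 0"
  then have "A *v x \<noteq> 0" using Sigma_A_apply[of x] by (metis matrix_vector_mult_0_right)
  then have "0 < (A *v x) \<bullet> (\<Sigma> *v (A *v x))" using pos_def by (simp add: sym_pos_def_def)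
  then show ?thesis by (simp add: Sigma_A_apply q_def inner_commute)
qed

lemma continuous_q: "continuous_on S q"
  unfolding q_def by (intro continuous_intros matrix_vector_mult_linear_continuous_on)

lemma q_scale: "q (c *\<^sub>R x) = c\<^sup>2 * q x"
  by (simp add: q_def matrix_vector_mult_scaleR power2_eq_square)

text \<open>The minimum of \<open>q\<close> on the unit sphere is positive, and homogeneity of
  degree 2 spreads it to a quadratic lower bound on the whole space.\<close>

lemma q_coercive: "\<exists>R. \<forall>x. R \<le> norm x \<longrightarrow> b \<le> q x"
proof -
  have "compact (sphere (0::real^'n) 1)" "sphere (0::real^'n) 1 \<noteq> {}" by auto
  from continuous_attains_inf[OF this continuous_q] obtain u :: "real ^ 'n"
    where u: "norm u = 1" "\<And>y. norm y = 1 \<Longrightarrow> q u \<le> q y" by auto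
  then have m: "0 < q u" using q_pos[of u] by fastforce
  have lower: "q u * (norm x)\<^sup>2 \<le> q x" for x
  proof (cases "x = 0")
    case False
    have "q x = (norm x)\<^sup>2 * q (x /\<^sub>R norm x)"
      using q_scale[of "norm x" "x /\<^sub>R norm x"] False by simp
    moreover have "q u \<le> q (x /\<^sub>R norm x)" using u(2) False by simp
    ultimately show ?thesis by (metis mult.commute mult_left_mono zero_le_power2)
  qed (simp add: q_def)
  \<comment> \<open>The 1 in the maximum ensures that the norm is at most its square, so a linear
    threshold \<open>b / q u\<close> suffices.\<close>
  have "b \<le> q x" if "max 1 (b / q u) \<le> norm x" for x
  proof -
    have "b / q u \<le> norm x" "norm x \<le> (norm x)\<^sup>2"
      using that by (auto intro: self_le_power)
    then have "b \<le> q u * norm x" "q u * norm x \<le> q u * (norm x)\<^sup>2"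
      using m by (simp_all add: pos_divide_le_eq mult.commute)
    then show ?thesis using lower[of x] by linarith
  qed
  then show ?thesis by blast
qed

lemma q_has_derivative: "(q has_derivative (\<lambda>h. 2 * ((A *v x) \<bullet> h))) (at x)"
proof -
  have "(q has_derivative (\<lambda>h. x \<bullet> (A *v h) + h \<bullet> (A *v x))) (at x)"
    unfolding q_def
    by (intro has_derivative_inner has_derivative_ident
        bounded_linear.has_derivative[OF matrix_vector_mul_bounded_linear])
  \<comment> \<open>Symmetry of \<open>A\<close> merges the two halves of the product rule.\<close>
  moreover have "x \<bullet> (A *v h) + h \<bullet> (A *v x) = 2 * ((A *v x) \<bullet> h)" for h
    using A_inner_commute[of x h] inner_commute[of h "A *v x"] by linarith
  ultimately show ?thesis by (simp only:)
qed

section \<open>The Gaussian density: derivative, measurability and sign\<close>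

lemma mvn_density_eq:
  "mvn_density \<Sigma> x = exp (- q x / 2) / sqrt ((2 * pi) ^ CARD('n) * det \<Sigma>)"
  by (simp add: mvn_density_def q_def A_def)

lemma mvn_density_has_derivative:
  "(mvn_density \<Sigma> has_derivative (\<lambda>h. - mvn_density \<Sigma> x * ((A *v x) \<bullet> h))) (at x)"
proof -
  \<comment> \<open>The derivative formula holds for any constant \<open>D\<close>, so the
    determinant stays opaque here.\<close>
  define D where "D = sqrt ((2 * pi) ^ CARD('n) * det \<Sigma>)"
  have p: "mvn_density \<Sigma> = (\<lambda>x. (1 / D) * exp (- (1 / 2) * q x))"
    unfolding mvn_density_eq[abs_def] D_def[symmetric] by simp
  show ?thesis
    unfolding p
    by (rule has_derivative_eq_rhs[OF has_derivative_mult_right[OF has_derivative_exp[OF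
          has_derivative_mult_right[OF q_has_derivative]]]]) (simp add: fun_eq_iff)
qed

lemma mvn_density_measurable: "mvn_density \<Sigma> \<in> borel_measurable borel"
  by (intro borel_measurable_continuous_onI continuous_at_imp_continuous_on ballI)
     (metis has_derivative_continuous mvn_density_has_derivative)

(* Total mass 1 replaces the determinant here: with det Sigma < 0 the density would be negative
   everywhere (Isabelle's sqrt is odd), hence ennreal of it would vanish. *)
lemma mvn_density_nonneg:
  assumes "prob_space (density lborel (\<lambda>x. ennreal (mvn_density \<Sigma> x)))"
  shows "0 \<le> mvn_density \<Sigma> x"
proof (rule ccontr)
  assume "\<not> 0 \<le> mvn_density \<Sigma> x"
  then have "sqrt ((2 * pi) ^ CARD('n) * det \<Sigma>) < 0"
    unfolding mvn_density_eq by (metis divide_nonneg_nonneg exp_ge_zero not_le)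
  then have "ennreal (mvn_density \<Sigma> y) = 0" for y
    unfolding mvn_density_eq by (intro ennreal_neg divide_nonneg_neg) auto
  then show False
    using prob_space.emeasure_space_1[OF assms] by (simp add: emeasure_density)
qed

section \<open>The kernel \<open>tau2\<close>: divergence, trace against \<open>A\<close>, and
  integrability of the gradient\<close>

definition K :: "real ^ 'n \<Rightarrow> real ^ 'n ^ 'n" where "K x = q x *\<^sub>R \<Sigma> - outer_prod x x"

lemma K_nth: "K x $ i $ j = q x * \<Sigma> $ i $ j - x $ i * x $ j"
  by (simp add: K_def outer_prod_def)

text \<open>For \<open>y = A *v x\<close> the two terms cancel: \<open>K x\<close> annihilates the
  gradient of the log density, which is what the divergence computation exploits.\<close>

lemma K_apply: "K x *v y = q x *\<^sub>R (\<Sigma> *v y) - (x \<bullet> y) *\<^sub>R x"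
proof -
  have "outer_prod x x *v y = (x \<bullet> y) *\<^sub>R x"
    by (simp add: vec_eq_iff outer_prod_def matrix_vector_mult_def inner_vec_def
        sum_distrib_left sum_distrib_right mult_ac)
  then show ?thesis
    by (simp add: K_def matrix_vector_mult_diff_rdistrib scaleR_matrix_vector_assoc[symmetric])
qed

lemma tau2_eq: "tau2 \<Sigma> \<beta> x =
    (\<beta> / ((\<beta> - 2) * (real CARD('n) - 1))) *\<^sub>R K x - (2 / (\<beta> - 2)) *\<^sub>R \<Sigma>"
  by (simp add: tau2_def K_def q_def A_def)

lemma tau2_has_derivative: "((\<lambda>x. tau2 \<Sigma> \<beta> x $ i $ j) has_derivative
    (\<lambda>h. \<beta> / ((\<beta> - 2) * (real CARD('n) - 1)) *
      (2 * ((A *v x) \<bullet> h) * \<Sigma> $ i $ j - (x $ i * h $ j + h $ i * x $ j)))) (at x)"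
  unfolding tau2_eq vector_minus_component vector_scaleR_component K_nth real_scaleR_def
  by (rule has_derivative_eq_rhs[OF has_derivative_diff[OF has_derivative_mult_right[OF
        has_derivative_diff[OF has_derivative_mult_left[OF q_has_derivative]
          has_derivative_mult[OF bounded_linear.has_derivative[OF bounded_linear_vec_nth has_derivative_ident]
            bounded_linear.has_derivative[OF bounded_linear_vec_nth has_derivative_ident]]]]
        has_derivative_const]]) simp

text \<open>Differentiating the density contributes minus the kernel applied to
  \<open>A *v x\<close>, where only the multiple of \<open>\<Sigma>\<close> survives, giving 2 /
  (\<beta> - 2) times x. Differentiating the kernel contributes -\<beta> / (\<beta> - 2) times x.
  The coefficients add up to -1.\<close>

lemma divergence_density_tau2:
  assumes "CARD('n) \<ge> 2" "\<beta> \<noteq> 2"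
  shows "(\<Sum>j\<in>UNIV. dir_deriv (\<lambda>x. mvn_density \<Sigma> x * tau2 \<Sigma> \<beta> x $ i $ j) (axis j 1) x)
    = - mvn_density \<Sigma> x * x $ i"
proof -
  define c where "c = \<beta> / ((\<beta> - 2) * (real CARD('n) - 1))"
  have c: "c * (1 - real CARD('n)) = - \<beta> / (\<beta> - 2)"
    using assms by (simp add: c_def divide_simps) (simp add: algebra_simps)
  \<comment> \<open>\<open>?D j\<close> is the partial derivative along \<open>axis j 1\<close> of
    entry (i, j) of the kernel. The conditional is a Kronecker delta, so summing the quadratic part
    gives d + 1 copies of \<open>x $ i\<close>, against 2 from the derivative of \<open>q\<close>;
    hence the factor 1 - d in \<open>c\<close>.\<close>
  let ?D = "\<lambda>j. c * (2 * (A *v x) $ j * \<Sigma> $ i $ j - (x $ i + (if i = j then x $ j else 0)))"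
  have "dir_deriv (\<lambda>x. mvn_density \<Sigma> x * tau2 \<Sigma> \<beta> x $ i $ j) (axis j 1) x
    = mvn_density \<Sigma> x * (?D j - tau2 \<Sigma> \<beta> x $ i $ j * (A *v x) $ j)" for j
    by (subst dir_deriv_eq[OF has_derivative_mult[OF mvn_density_has_derivative tau2_has_derivative]])
       (simp add: inner_axis c_def[symmetric], simp add: axis_def algebra_simps)
  then have "(\<Sum>j\<in>UNIV. dir_deriv (\<lambda>x. mvn_density \<Sigma> x * tau2 \<Sigma> \<beta> x $ i $ j) (axis j 1) x)
    = mvn_density \<Sigma> x * ((\<Sum>j\<in>UNIV. ?D j) - (tau2 \<Sigma> \<beta> x *v (A *v x)) $ i)"
    by (simp add: sum_distrib_left[symmetric] sum_subtractf matrix_vector_mult_def[of "tau2 \<Sigma> \<beta> x"])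
  also have "(\<Sum>j\<in>UNIV. ?D j) = c * (2 * (\<Sigma> *v (A *v x)) $ i - (real CARD('n) * x $ i + x $ i))"
    by (simp add: sum_distrib_left[symmetric] sum_subtractf sum.distrib
        matrix_vector_mult_def[of \<Sigma>] mult_ac)
  also have "\<dots> = c * (1 - real CARD('n)) * x $ i"
    by (simp add: Sigma_A_apply algebra_simps)
  also have "(tau2 \<Sigma> \<beta> x *v (A *v x)) $ i = - (2 / (\<beta> - 2)) * x $ i"
    by (simp add: tau2_eq matrix_vector_mult_diff_rdistrib scaleR_matrix_vector_assoc[symmetric]
        K_apply Sigma_A_apply q_def)
  finally have "(\<Sum>j\<in>UNIV. dir_deriv (\<lambda>x. mvn_density \<Sigma> x * tau2 \<Sigma> \<beta> x $ i $ j) (axis j 1) x)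
    = mvn_density \<Sigma> x * ((- \<beta> / (\<beta> - 2) + 2 / (\<beta> - 2)) * x $ i)"
    unfolding c by (simp add: algebra_simps)
  also have "- \<beta> / (\<beta> - 2) + 2 / (\<beta> - 2) = - 1"
    using assms by (simp add: divide_simps)
  finally show ?thesis by simp
qed

text \<open>Pairing with \<open>A\<close> sends \<open>\<Sigma>\<close> to d and the outer product
  of x to \<open>q x\<close>, so \<open>K x\<close> goes to (d - 1) \<open>q x\<close> and the
  factor d - 1 cancels.\<close>

lemma trace_A_tau2:
  assumes "CARD('n) \<ge> 2" "\<beta> \<noteq> 2"
  shows "(\<Sum>i\<in>UNIV. \<Sum>j\<in>UNIV. A $ i $ j * tau2 \<Sigma> \<beta> x $ i $ j)
    = (\<beta> * q x - 2 * real CARD('n)) / (\<beta> - 2)"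
proof -
  define c where "c = \<beta> / ((\<beta> - 2) * (real CARD('n) - 1))"
  have c: "c * (real CARD('n) - 1) = \<beta> / (\<beta> - 2)"
    using assms by (simp add: c_def)
  \<comment> \<open>Symmetry turns the entrywise pairing into the trace of a matrix product.\<close>
  have "\<Sigma> $ i $ j = \<Sigma> $ j $ i" for i j
    using transpose_Sigma by (metis transpose_def vec_lambda_beta)
  then have "(\<Sum>i\<in>UNIV. \<Sum>j\<in>UNIV. A $ i $ j * \<Sigma> $ i $ j) =
      (\<Sum>i\<in>UNIV. \<Sum>j\<in>UNIV. A $ i $ j * \<Sigma> $ j $ i)"
    by (intro sum.cong refl arg_cong[where f = "(*) _"])
  also have "\<dots> = trace (A ** \<Sigma>)"
    by (simp add: trace_def matrix_matrix_mult_def)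
  also have "\<dots> = real CARD('n)"
    unfolding inverse_Sigma by (rule trace_I)
  finally have S: "(\<Sum>i\<in>UNIV. \<Sum>j\<in>UNIV. A $ i $ j * \<Sigma> $ i $ j) = real CARD('n)" .
  have Q: "(\<Sum>i\<in>UNIV. \<Sum>j\<in>UNIV. A $ i $ j * (x $ i * x $ j)) = q x"
    by (simp add: q_def inner_vec_def matrix_vector_mult_def sum_distrib_left mult_ac)
  have "(\<Sum>i\<in>UNIV. \<Sum>j\<in>UNIV. A $ i $ j * tau2 \<Sigma> \<beta> x $ i $ j)
     = (c * q x - 2 / (\<beta> - 2)) * (\<Sum>i\<in>UNIV. \<Sum>j\<in>UNIV. A $ i $ j * \<Sigma> $ i $ j)
       - c * (\<Sum>i\<in>UNIV. \<Sum>j\<in>UNIV. A $ i $ j * (x $ i * x $ j))"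
    unfolding sum_distrib_left sum_subtractf[symmetric] tau2_eq c_def[symmetric]
    by (intro sum.cong refl) (simp add: K_nth algebra_simps)
  also have "\<dots> = c * (real CARD('n) - 1) * q x - 2 * real CARD('n) / (\<beta> - 2)"
    unfolding S Q by (simp add: algebra_simps)
  finally show ?thesis unfolding c by (simp only: diff_divide_distrib times_divide_eq_left)
qed

text \<open>Fix a partial derivative of \<open>g\<close>. Its products with all entries of the
  kernel are integrable, so contracting with \<open>A\<close> leaves it multiplied by the scalar
  trace, which can be divided out far from the origin.\<close>

lemma integrable_grad:
  assumes "CARD('n) \<ge> 2" "\<beta> \<noteq> 2" "\<beta> \<noteq> 0"
    and g: "g \<in> stein_dom p (tau2 \<Sigma> \<beta>)"
    and N: "prob_space (density lborel (\<lambda>x. ennreal (p x)))"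
  shows "integrable (density lborel (\<lambda>x. ennreal (p x))) (grad g)"
  unfolding integrable_vec_iff
proof
  fix k
  let ?N = "density lborel (\<lambda>x. ennreal (p x))"
  let ?T = "\<lambda>x. (\<beta> * q x - 2 * real CARD('n)) / (\<beta> - 2)"
  \<comment> \<open>The direction \<open>k\<close> is independent of the matrix index
    \<open>j\<close>: \<open>stein_dom\<close> controls every entry times every directional
    derivative, not just the matched products.\<close>
  have "integrable ?N (\<lambda>x. tau2 \<Sigma> \<beta> x $ i $ j * grad g x $ k)" for i j
    using g unfolding stein_dom_def L1_weighted_def by (auto simp: grad_def norm_axis_1)
  then have "integrable ?N (\<lambda>x. \<Sum>i\<in>UNIV. \<Sum>j\<in>UNIV. A $ i $ j * (tau2 \<Sigma> \<beta> x $ i $ j * grad g x $ k))"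
    by auto
  moreover have "(\<Sum>i\<in>UNIV. \<Sum>j\<in>UNIV. A $ i $ j * (tau2 \<Sigma> \<beta> x $ i $ j * grad g x $ k)) =
      ?T x * grad g x $ k" for x
    unfolding trace_A_tau2[OF assms(1,2), symmetric] sum_distrib_right mult.assoc ..
  ultimately have int: "integrable ?N (\<lambda>x. ?T x * grad g x $ k)"
    by (simp only:)
  \<comment> \<open>The threshold is what makes the numerator of \<open>?T\<close> at least |\<beta>
    - 2| in absolute value, after losing 2d to the triangle inequality.\<close>
  obtain R where R: "\<And>x. R \<le> norm x \<Longrightarrow> (\<bar>\<beta> - 2\<bar> + 2 * real CARD('n)) / \<bar>\<beta>\<bar> \<le> q x"
    using q_coercive by blast
  have bound: "1 \<le> \<bar>?T x\<bar>" if "R \<le> norm x" for x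
  proof -
    have "\<bar>\<beta> - 2\<bar> + 2 * real CARD('n) \<le> \<bar>\<beta>\<bar> * q x"
      using R[OF that] assms(3) by (simp add: pos_divide_le_eq mult.commute)
    also have "\<dots> \<le> \<bar>\<beta> * q x\<bar>" by (simp add: abs_mult mult_left_mono)
    finally have "\<bar>\<beta> - 2\<bar> \<le> \<bar>\<beta> * q x - 2 * real CARD('n)\<bar>" by linarith
    then show ?thesis using assms(2) by (simp only: abs_divide le_divide_eq_1_pos zero_less_abs_iff)
  qed
  have cont: "continuous_on UNIV (\<lambda>x. grad g x $ k)"
    using g unfolding stein_dom_def C1_fun_def by (auto intro: continuous_intros)
  have "finite_measure ?N" using N unfolding prob_space_def by (rule conjunct1)
  then show "integrable ?N (\<lambda>x. grad g x $ k)"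
    by (rule integrable_of_integrable_mult_bounded_below[OF int _ _ cont bound]) simp
qed

end

section \<open>Splitting the kernel identity under the law of \<open>X\<close> and transporting it
  to the expectations\<close>

theorem mainTheorem9:
  fixes \<Sigma> :: "real ^ 'n ^ 'n"
    and M :: "'a measure"
    and X :: "'a \<Rightarrow> real ^ 'n"
    and \<beta> :: real
    and g :: "real ^ 'n \<Rightarrow> real"
  assumes "CARD('n) \<ge> 2"
    and "sym_pos_def \<Sigma>"
    and "prob_space M"
    and "distributed M lborel X (\<lambda>x. ennreal (mvn_density \<Sigma> x))"
    and "\<beta> \<noteq> 2"
    and "g \<in> stein_dom (mvn_density \<Sigma>) (tau2 \<Sigma> \<beta>)"
  shows "integrable M (\<lambda>\<omega>. (\<beta> / ((\<beta> - 2) * (real CARD('n) - 1))) *\<^sub>R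
             (((X \<omega> \<bullet> (matrix_inv \<Sigma> *v X \<omega>)) *\<^sub>R \<Sigma> - outer_prod (X \<omega>) (X \<omega>)) *v grad g (X \<omega>)))
       \<and> integrable M (\<lambda>\<omega>. (2 / (\<beta> - 2)) *\<^sub>R (\<Sigma> *v grad g (X \<omega>)) + g (X \<omega>) *\<^sub>R X \<omega>)
       \<and> (\<beta> / ((\<beta> - 2) * (real CARD('n) - 1))) *\<^sub>R
           (\<integral>\<omega>. ((X \<omega> \<bullet> (matrix_inv \<Sigma> *v X \<omega>)) *\<^sub>R \<Sigma> - outer_prod (X \<omega>) (X \<omega>)) *v grad g (X \<omega>) \<partial>M)
         = (\<integral>\<omega>. (2 / (\<beta> - 2)) *\<^sub>R (\<Sigma> *v grad g (X \<omega>)) + g (X \<omega>) *\<^sub>R X \<omega> \<partial>M)"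
proof -
  interpret pos_def_matrix \<Sigma> by standard fact
  define N where "N = density lborel (\<lambda>x. ennreal (mvn_density \<Sigma> x))"
  define c where "c = \<beta> / ((\<beta> - 2) * (real CARD('n) - 1))"
  define s where "s = 2 / (\<beta> - 2)"
  have X: "X \<in> measurable M borel" and distr: "distr M borel X = N"
    using assms(4) unfolding distributed_def N_def
    by (auto cong: distr_cong simp: measurable_lborel1)
  \<comment> \<open>As the law of \<open>X\<close>, \<open>N\<close> has total mass 1; this supplies
    both the sign of the density and the finiteness of the measure.\<close>
  have N: "prob_space N"
    using prob_space.prob_space_distr[OF assms(3) X] distr by simp
  have C1: "C1_fun g" using assms(6) by (simp add: stein_dom_def)
  have Kg_meas: "(\<lambda>x. K x *v grad g x) \<in> borel_measurable borel"
    and Sg_meas: "(\<lambda>x. s *\<^sub>R (\<Sigma> *v grad g x) + g x *\<^sub>R x) \<in> borel_measurable borel"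
    unfolding K_apply
    by (intro borel_measurable_continuous_onI continuous_intros continuous_q C1_fun_continuous[OF C1]
        bounded_linear.continuous_on[OF matrix_vector_mul_bounded_linear])+
  have nonneg: "0 \<le> mvn_density \<Sigma> x" for x
    using N mvn_density_nonneg by (simp add: N_def)
  have diff: "(\<lambda>x. mvn_density \<Sigma> x * tau2 \<Sigma> \<beta> x $ i $ j) differentiable (at x)" for i j x
    by (intro differentiable_mult differentiableI)
       (rule mvn_density_has_derivative tau2_has_derivative)+
  \<comment> \<open>Row \<open>i\<close> of the kernel has \<open>v x = x $ i\<close>, by the
    divergence formula.\<close>
  have ibp: "integrable N (\<lambda>x. x $ i * g x)"
      "(\<integral>x. (tau2 \<Sigma> \<beta> x *v grad g x) $ i \<partial>N) = (\<integral>x. x $ i * g x \<partial>N)" for i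
    unfolding N_def
    by (rule stein_dom_integration_by_parts[OF assms(6) nonneg mvn_density_measurable diff
          divergence_density_tau2[OF assms(1,5)]], simp)+
  have xg: "integrable N (\<lambda>x. g x *\<^sub>R x)"
    using ibp(1) by (simp add: integrable_vec_iff mult.commute)
  have "integrable N (\<lambda>x. tau2 \<Sigma> \<beta> x $ i $ j * dir_deriv g (axis j 1) x)" for i j
    using assms(6) unfolding stein_dom_def L1_weighted_def N_def by (auto simp: norm_axis_1)
  then have tg: "integrable N (\<lambda>x. tau2 \<Sigma> \<beta> x *v grad g x)"
    by (auto simp: integrable_vec_iff matrix_vector_mult_def grad_def)
  have tau_g: "tau2 \<Sigma> \<beta> x *v grad g x = c *\<^sub>R (K x *v grad g x) - s *\<^sub>R (\<Sigma> *v grad g x)" for x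
    by (simp add: tau2_eq c_def s_def matrix_vector_mult_diff_rdistrib
        scaleR_matrix_vector_assoc[symmetric])
  have Sg: "integrable N (\<lambda>x. s *\<^sub>R (\<Sigma> *v grad g x))"
  \<comment> \<open>The radius in \<open>integrable_grad\<close> divides by |\<beta>|. At
    \<open>\<beta> = 0\<close> the kernel is \<open>\<Sigma>\<close> itself, so \<open>tg\<close> is
    already the claim up to sign.\<close>
  proof (cases "\<beta> = 0")
    case True
    then have "c = 0" by (simp add: c_def)
    then show ?thesis using tg unfolding tau_g by simp
  next
    case False
    have "integrable N (grad g)"
      unfolding N_def using integrable_grad[OF assms(1,5) False assms(6)] N by (simp add: N_def)
    then show ?thesis
      by (auto intro!: integrable_bounded_linear[OF matrix_vector_mul_bounded_linear])
  qed
  have cKg_eq: "c *\<^sub>R (K x *v grad g x) = tau2 \<Sigma> \<beta> x *v grad g x + s *\<^sub>R (\<Sigma> *v grad g x)" for x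
    by (simp add: tau_g)
  have cKg: "integrable N (\<lambda>x. c *\<^sub>R (K x *v grad g x))"
    unfolding cKg_eq using tg Sg by auto
  have "(\<integral>x. tau2 \<Sigma> \<beta> x *v grad g x \<partial>N) = (\<integral>x. g x *\<^sub>R x \<partial>N)"
    using tg xg ibp(2) by (simp add: vec_eq_iff integral_vec_nth mult.commute)
  then have "(\<integral>x. c *\<^sub>R (K x *v grad g x) \<partial>N) = (\<integral>x. s *\<^sub>R (\<Sigma> *v grad g x) + g x *\<^sub>R x \<partial>N)"
    unfolding cKg_eq using tg Sg xg by simp
  \<comment> \<open>At \<open>c = 0\<close> the inner integral may be the default value 0 of a
    non-integrable function; the factor \<open>c\<close> makes the equation hold regardless.\<close>
  then have "c *\<^sub>R (\<integral>x. K x *v grad g x \<partial>N) = (\<integral>x. s *\<^sub>R (\<Sigma> *v grad g x) + g x *\<^sub>R x \<partial>N)"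
    by simp
  moreover have "integrable N (\<lambda>x. s *\<^sub>R (\<Sigma> *v grad g x) + g x *\<^sub>R x)"
    using Sg xg by auto
  \<comment> \<open>Change of variables for an image measure asks for Borel integrands; here they
    are continuous because \<open>g\<close> is C1.\<close>
  moreover have transfer: "integrable N f \<longleftrightarrow> integrable M (\<lambda>\<omega>. f (X \<omega>))"
      "integral\<^sup>L N f = (\<integral>\<omega>. f (X \<omega>) \<partial>M)"
    if "f \<in> borel_measurable borel" for f :: "real ^ 'n \<Rightarrow> real ^ 'n"
    using that X unfolding distr[symmetric] by (simp_all add: integrable_distr_eq integral_distr)
  moreover have "(\<lambda>x. c *\<^sub>R (K x *v grad g x)) \<in> borel_measurable borel"
    using Kg_meas by simp
  ultimately show ?thesis
    using cKg Kg_meas Sg_meas unfolding c_def s_def K_def q_def A_def by simp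
qed

end
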